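(* Let $\mathcal{G}=(B,\psi,A)$ be a $d$-regular quantum graph. Then the identity \[ \|A\|_{\mathrm{op}}=d \] between the operator norm of $A$ on $L^2(\mathcal{G})=L^2(B,\psi)$ and the degree holds if any one of the following is satisfied: (1) $\mathcal{G}$ is undirected, in which case moreover $\mathrm{spec}(A)\subset[-d,d]$; (2) both $A$ and $A^\dagger$ are real; (3) $\mathcal{G}$ is real and tracial.
   Context: A quantum set is a pair $(B,\psi)$ where $B$ is a finite-dimensional $C^*$-algebra with multiplication $m:B\otimes B\to B$, and $\psi$ is a faithful state on $B$ that is a $\delta$-form, i.e. $mm^\dagger=\delta^2\,\mathrm{id}_B$ for some $\delta\ge 0$. Here $B$ is regarded as the Hilbert space $L^2(B,\psi)$ with inner product $\langle x|y\rangle=\psi(x^*y)$, $B\otimes B$ carries the inner product from $\psi\otimes\psi$, and $(\cdot)^\dagger$ is the Hilbert space adjoint of operators. For linear maps $S,T:B\to B$, the Schur product is $S\bullet T=\delta^{-2}m(S\otimes T)m^\dagger$ and the involution is $T^*(x)=(T(x^* ))^*$; $T$ is called real if $T^*=T$. A quantum graph is a triple $(B,\psi,A)$ with $(B,\psi)$ a quantum set and $A:B\to B$ linear satisfying $A\bullet A=A$. It is real if $A$ is real; undirected if $A$ is real and $A=A^\dagger$; tracial if $\psi$ is a trace; and $d$-regular ($d\in\mathbb{C}$) if $A1_B=d1_B=A^\dagger 1_B$. *)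

theory Defs
  imports "HOL-Analysis.Analysis" "HOL-Library.Poly_Mapping"
begin

section \<open>Complex vector spaces\<close>

class complex_vector = ab_group_add +
  fixes scaleC :: "complex \<Rightarrow> 'a \<Rightarrow> 'a" (infixr \<open>*\<^sub>C\<close> 75)
  assumes scaleC_add_right: "a *\<^sub>C (x + y) = a *\<^sub>C x + a *\<^sub>C y"
    and scaleC_add_left: "(a + b) *\<^sub>C x = a *\<^sub>C x + b *\<^sub>C x"
    and scaleC_scaleC: "a *\<^sub>C b *\<^sub>C x = (a * b) *\<^sub>C x"
    and scaleC_one: "1 *\<^sub>C x = x"

global_interpretation complex_vector:
  vector_space "scaleC :: complex \<Rightarrow> 'a \<Rightarrow> 'a::complex_vector"
  by unfold_locales (rule scaleC_add_right scaleC_add_left scaleC_scaleC scaleC_one)+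

abbreviation clinear :: "('a::complex_vector \<Rightarrow> 'b::complex_vector) \<Rightarrow> bool" where
  "clinear \<equiv> Vector_Spaces.linear scaleC scaleC"

instantiation complex :: complex_vector
begin

definition scaleC_complex :: "complex \<Rightarrow> complex \<Rightarrow> complex" where
  [simp]: "scaleC_complex a z = a * z"

instance
  by standard (auto simp: algebra_simps)

end

instantiation poly_mapping :: (type, complex_vector) complex_vector
begin

lift_definition scaleC_poly_mapping :: "complex \<Rightarrow> ('a \<Rightarrow>\<^sub>0 'b) \<Rightarrow> ('a \<Rightarrow>\<^sub>0 'b)"
  is "\<lambda>c f k. c *\<^sub>C f k"
  by (rule finite_subset[rotated]) auto

instance
  by standard
    (transfer; simp add: fun_eq_iff scaleC_add_right scaleC_add_left scaleC_scaleC scaleC_one)+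

end

lemma clinearI:
  assumes "\<And>x y. f (x + y) = f x + f y" and "\<And>c x. f (c *\<^sub>C x) = c *\<^sub>C f x"
  shows "clinear f"
  using assms
  by (auto intro!: Vector_Spaces.linear.intro module_hom.intro module_hom_axioms.intro
      complex_vector.vector_space_axioms complex_vector.module_axioms)

lemma clinear_add: "clinear f \<Longrightarrow> f (x + y) = f x + f y"
  by (auto simp: Vector_Spaces.linear_def intro: module_hom.add)

lemma clinear_scale: "clinear f \<Longrightarrow> f (c *\<^sub>C x) = c *\<^sub>C f x"
  by (auto simp: Vector_Spaces.linear_def intro: module_hom.scale)

lemma clinear_zero: "clinear f \<Longrightarrow> f 0 = 0"
  by (auto simp: Vector_Spaces.linear_def intro: module_hom.zero)

lemma clinear_diff: "clinear f \<Longrightarrow> f (x - y) = f x - f y"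
  by (auto simp: Vector_Spaces.linear_def intro: module_hom.diff)

definition cbilinear ::
  "('a::complex_vector \<Rightarrow> 'b::complex_vector \<Rightarrow> 'c::complex_vector) \<Rightarrow> bool" where
  "cbilinear \<beta> \<longleftrightarrow> (\<forall>x. clinear (\<beta> x)) \<and> (\<forall>y. clinear (\<lambda>x. \<beta> x y))"

section \<open>The algebraic tensor product\<close>

text \<open>
  The tensor product is the quotient of the free complex vector space on pairs by the
  subspace spanned by the bilinearity relations.
\<close>

abbreviation free_pair :: "'a \<Rightarrow> 'b \<Rightarrow> ('a \<times> 'b) \<Rightarrow>\<^sub>0 complex" where
  "free_pair a b \<equiv> Poly_Mapping.single (a, b) 1"

definition tensor_relators :: "(('a::complex_vector \<times> 'b::complex_vector) \<Rightarrow>\<^sub>0 complex) set" where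
  "tensor_relators =
     {free_pair (a + a') b - free_pair a b - free_pair a' b | a a' b. True}
   \<union> {free_pair a (b + b') - free_pair a b - free_pair a b' | a b b'. True}
   \<union> {free_pair (c *\<^sub>C a) b - c *\<^sub>C free_pair a b | c a b. True}
   \<union> {free_pair a (c *\<^sub>C b) - c *\<^sub>C free_pair a b | c a b. True}"

definition tensor_eq ::
  "(('a::complex_vector \<times> 'b::complex_vector) \<Rightarrow>\<^sub>0 complex) \<Rightarrow>
   (('a \<times> 'b) \<Rightarrow>\<^sub>0 complex) \<Rightarrow> bool" where
  "tensor_eq s t \<longleftrightarrow> s - t \<in> complex_vector.span tensor_relators"

lemma tensor_eq_add:
  assumes "tensor_eq s s'" and "tensor_eq t t'"
  shows "tensor_eq (s + t) (s' + t')"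
  using complex_vector.span_add[OF assms[unfolded tensor_eq_def]]
  by (simp add: tensor_eq_def algebra_simps)

lemma tensor_eq_diff:
  assumes "tensor_eq s s'" and "tensor_eq t t'"
  shows "tensor_eq (s - t) (s' - t')"
  using complex_vector.span_diff[OF assms[unfolded tensor_eq_def]]
  by (simp add: tensor_eq_def algebra_simps)

lemma tensor_eq_scale: "tensor_eq s t \<Longrightarrow> tensor_eq (c *\<^sub>C s) (c *\<^sub>C t)"
  using complex_vector.span_scale[of "s - t" tensor_relators c]
  by (simp add: tensor_eq_def complex_vector.scale_right_diff_distrib)

lemma tensor_eq_refl: "tensor_eq s s"
  by (simp add: tensor_eq_def complex_vector.span_zero)

lemma equivp_tensor_eq:
  "equivp (tensor_eq :: (('a::complex_vector \<times> 'b::complex_vector) \<Rightarrow>\<^sub>0 complex) \<Rightarrow> _)"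
  (is "equivp ?R")
proof (rule equivpI)
  show "reflp ?R"
    by (simp add: reflp_def tensor_eq_refl)
  show "symp ?R"
    by (rule sympI) (use complex_vector.span_neg in \<open>force simp: tensor_eq_def\<close>)
  show "transp ?R"
  proof (rule transpI)
    fix s t u :: "('a \<times> 'b) \<Rightarrow>\<^sub>0 complex"
    assume "tensor_eq s t" "tensor_eq t u"
    then show "tensor_eq s u"
      using complex_vector.span_add[of "s - t" tensor_relators "t - u"]
      by (simp add: tensor_eq_def)
  qed
qed

quotient_type (overloaded) ('a, 'b) tensor =
  "('a::complex_vector \<times> 'b::complex_vector) \<Rightarrow>\<^sub>0 complex" / tensor_eq
  by (rule equivp_tensor_eq)

instantiation tensor :: (complex_vector, complex_vector) complex_vector
begin

lift_definition zero_tensor :: "('a, 'b) tensor" is 0 .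

lift_definition plus_tensor :: "('a, 'b) tensor \<Rightarrow> ('a, 'b) tensor \<Rightarrow> ('a, 'b) tensor" is "(+)"
  by (rule tensor_eq_add)

lift_definition minus_tensor :: "('a, 'b) tensor \<Rightarrow> ('a, 'b) tensor \<Rightarrow> ('a, 'b) tensor" is "(-)"
  by (rule tensor_eq_diff)

lift_definition uminus_tensor :: "('a, 'b) tensor \<Rightarrow> ('a, 'b) tensor" is uminus
  using tensor_eq_diff[OF tensor_eq_refl, of _ _ 0] by simp

lift_definition scaleC_tensor :: "complex \<Rightarrow> ('a, 'b) tensor \<Rightarrow> ('a, 'b) tensor" is scaleC
  by (rule tensor_eq_scale)

instance
  by standard
    (transfer; simp add: algebra_simps scaleC_add_right scaleC_add_left scaleC_scaleC scaleC_one
       tensor_eq_refl)+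

end

lift_definition tensor_pair ::
  "'a::complex_vector \<Rightarrow> 'b::complex_vector \<Rightarrow> ('a, 'b) tensor" (infixr \<open>\<otimes>\<close> 70)
  is free_pair .

lemma cbilinear_tensor_pair: "cbilinear tensor_pair"
proof -
  have rel: "tensor_eq s t" if "s - t \<in> tensor_relators"
    for s t :: "('a \<times> 'b) \<Rightarrow>\<^sub>0 complex"
    using that by (simp add: tensor_eq_def complex_vector.span_base)
  have "(a + a') \<otimes> b = a \<otimes> b + a' \<otimes> b" for a a' :: 'a and b :: 'b
    by transfer (rule rel, force simp: tensor_relators_def algebra_simps)
  moreover have "a \<otimes> (b + b') = a \<otimes> b + a \<otimes> b'" for a :: 'a and b b' :: 'b
    by transfer (rule rel, force simp: tensor_relators_def algebra_simps)
  moreover have "(c *\<^sub>C a) \<otimes> b = c *\<^sub>C (a \<otimes> b)" for c and a :: 'a and b :: 'b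
    by transfer (rule rel, force simp: tensor_relators_def)
  moreover have "a \<otimes> (c *\<^sub>C b) = c *\<^sub>C (a \<otimes> b)" for c and a :: 'a and b :: 'b
    by transfer (rule rel, force simp: tensor_relators_def)
  ultimately show ?thesis
    unfolding cbilinear_def by (auto intro!: clinearI)
qed

definition free_extension ::
  "('a \<Rightarrow> 'b \<Rightarrow> 'c::complex_vector) \<Rightarrow> (('a \<times> 'b) \<Rightarrow>\<^sub>0 complex) \<Rightarrow> 'c" where
  "free_extension \<beta> s = (\<Sum>(a, b)\<in>Poly_Mapping.keys s. Poly_Mapping.lookup s (a, b) *\<^sub>C \<beta> a b)"

lemma free_extension_superset:
  assumes "finite K" and "Poly_Mapping.keys s \<subseteq> K"
  shows "free_extension \<beta> s = (\<Sum>(a, b)\<in>K. Poly_Mapping.lookup s (a, b) *\<^sub>C \<beta> a b)"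
  unfolding free_extension_def using assms
  by (intro sum.mono_neutral_left) (auto simp: in_keys_iff)

lemma clinear_free_extension: "clinear (free_extension \<beta>)"
proof (rule clinearI)
  fix s t :: "('a \<times> 'b) \<Rightarrow>\<^sub>0 complex" and c
  let ?K = "Poly_Mapping.keys s \<union> Poly_Mapping.keys t"
  show "free_extension \<beta> (s + t) = free_extension \<beta> s + free_extension \<beta> t"
    using Poly_Mapping.keys_add[of s t]
    by (simp add: free_extension_superset[where K = ?K] lookup_add case_prod_unfold
        scaleC_add_left sum.distrib)
  have "Poly_Mapping.keys (c *\<^sub>C s) \<subseteq> Poly_Mapping.keys s"
    by (auto simp: in_keys_iff scaleC_poly_mapping.rep_eq)
  then show "free_extension \<beta> (c *\<^sub>C s) = c *\<^sub>C free_extension \<beta> s"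
    by (simp add: free_extension_superset[where K = "Poly_Mapping.keys s"] case_prod_unfold
        scaleC_poly_mapping.rep_eq complex_vector.scale_sum_right scaleC_scaleC)
qed

lemma free_extension_pair [simp]: "free_extension \<beta> (free_pair a b) = \<beta> a b"
  by (simp add: free_extension_def scaleC_one)

lemma free_extension_tensor_eq:
  assumes "cbilinear \<beta>" and "tensor_eq s t"
  shows "free_extension \<beta> s = free_extension \<beta> t"
proof -
  note lin = clinear_free_extension[of \<beta>]
  have b: "\<beta> (x + x') y = \<beta> x y + \<beta> x' y" "\<beta> x (y + y') = \<beta> x y + \<beta> x y'"
    "\<beta> (c *\<^sub>C x) y = c *\<^sub>C \<beta> x y" "\<beta> x (c *\<^sub>C y) = c *\<^sub>C \<beta> x y" for x x' y y' c
    using assms(1) clinear_add[of "\<lambda>x. \<beta> x y"] clinear_scale[of "\<lambda>x. \<beta> x y"]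
      clinear_add[of "\<beta> x"] clinear_scale[of "\<beta> x"]
    by (auto simp: cbilinear_def)
  have "free_extension \<beta> r = 0" if "r \<in> complex_vector.span tensor_relators" for r
    using that
  proof (induction rule: complex_vector.span_induct_alt)
    case base
    show ?case by (rule clinear_zero[OF lin])
  next
    case (step c x y)
    then have "free_extension \<beta> x = 0"
      by (auto simp: tensor_relators_def clinear_diff[OF lin] clinear_scale[OF lin] b)
    with step show ?case
      by (simp add: clinear_add[OF lin] clinear_scale[OF lin])
  qed
  from this[of "s - t"] assms(2) show ?thesis
    by (simp add: tensor_eq_def clinear_diff[OF lin])
qed

text \<open>
  The linear map on the tensor product induced by a bilinear map; the value on maps that
  are not bilinear is a dummy.
\<close>

lift_definition tensor_lift ::
  "('a::complex_vector \<Rightarrow> 'b::complex_vector \<Rightarrow> 'c::complex_vector) \<Rightarrow> ('a, 'b) tensor \<Rightarrow> 'c"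
  is "\<lambda>\<beta> s. if cbilinear \<beta> then free_extension \<beta> s else 0"
  using free_extension_tensor_eq by auto

lemma tensor_lift_pair: "cbilinear \<beta> \<Longrightarrow> tensor_lift \<beta> (a \<otimes> b) = \<beta> a b"
  by transfer simp

lemma clinear_tensor_lift: "clinear (tensor_lift \<beta>)"
proof (rule clinearI)
  fix s t :: "('a, 'b) tensor" and c
  show "tensor_lift \<beta> (s + t) = tensor_lift \<beta> s + tensor_lift \<beta> t"
    by transfer (simp add: clinear_add[OF clinear_free_extension])
  show "tensor_lift \<beta> (c *\<^sub>C s) = c *\<^sub>C tensor_lift \<beta> s"
    by transfer (simp add: clinear_scale[OF clinear_free_extension])
qed

definition tensor_map ::
  "('a::complex_vector \<Rightarrow> 'c::complex_vector) \<Rightarrow> ('b::complex_vector \<Rightarrow> 'd::complex_vector) \<Rightarrow>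
   ('a, 'b) tensor \<Rightarrow> ('c, 'd) tensor" where
  "tensor_map S T = tensor_lift (\<lambda>a b. S a \<otimes> T b)"

section \<open>Finite-dimensional C*-algebras\<close>

class cstar_algebra = complex_vector + real_normed_algebra_1 + banach +
  fixes star :: "'a \<Rightarrow> 'a"
  assumes scaleR_scaleC: "r *\<^sub>R x = complex_of_real r *\<^sub>C x"
    and norm_scaleC: "norm (c *\<^sub>C x) = cmod c * norm x"
    and mult_scaleC_left: "(c *\<^sub>C x) * y = c *\<^sub>C (x * y)"
    and mult_scaleC_right: "x * (c *\<^sub>C y) = c *\<^sub>C (x * y)"
    and star_star: "star (star x) = x"
    and star_add: "star (x + y) = star x + star y"
    and star_scaleC: "star (c *\<^sub>C x) = cnj c *\<^sub>C star x"
    and star_mult: "star (x * y) = star y * star x"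
    and cstar_identity: "norm (star x * x) = (norm x)\<^sup>2"

class fd_cstar_algebra = cstar_algebra +
  assumes finite_dimensional: "\<exists>S. finite S \<and> (\<forall>x. \<exists>c. x = (\<Sum>b\<in>S. c b *\<^sub>C b))"

section \<open>Quantum sets\<close>

definition faithful_state :: "('b::cstar_algebra \<Rightarrow> complex) \<Rightarrow> bool" where
  "faithful_state \<psi> \<longleftrightarrow> clinear \<psi>
     \<and> (\<forall>x. \<psi> (star x * x) \<in> \<real> \<and> 0 \<le> Re (\<psi> (star x * x)))
     \<and> \<psi> 1 = 1
     \<and> (\<forall>x. \<psi> (star x * x) = 0 \<longrightarrow> x = 0)"

definition l2_inner :: "('b::cstar_algebra \<Rightarrow> complex) \<Rightarrow> 'b \<Rightarrow> 'b \<Rightarrow> complex" where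
  "l2_inner \<psi> x y = \<psi> (star x * y)"

lemma faithful_state_star:
  assumes "faithful_state \<psi>"
  shows "\<psi> (star z) = cnj (\<psi> z)"
proof -
  have lin: "clinear \<psi>" and one: "\<psi> 1 = 1" and im: "Im (\<psi> (star x * x)) = 0" for x
    using assms by (auto simp: faithful_state_def complex_is_Real_iff)
  have star_one: "star 1 = (1 :: 'a)"
    by (metis mult_1 mult_1_right star_mult star_star)
  note expand = star_add star_one star_scaleC algebra_simps mult_scaleC_left mult_scaleC_right
    clinear_diff[OF lin] clinear_add[OF lin] clinear_scale[OF lin] one im[of z]
  have "Im (\<psi> z) + Im (\<psi> (star z)) = 0"
    using im[of "1 + z"] by (simp add: expand)
  moreover have "Re (\<psi> z) - Re (\<psi> (star z)) = 0"
    using im[of "1 + \<i> *\<^sub>C z"] by (simp add: expand)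
  ultimately show ?thesis
    by (simp add: complex_eq_iff)
qed

lemma l2_inner_commute:
  assumes "faithful_state \<psi>"
  shows "l2_inner \<psi> x y = cnj (l2_inner \<psi> y x)"
  using faithful_state_star[OF assms, of "star y * x"]
  by (simp add: l2_inner_def star_mult star_star)

text \<open>
  The sesquilinear extension of
  \<open>\<langle>a \<otimes> b | c \<otimes> d\<rangle> = \<langle>a | c\<rangle> \<langle>b | d\<rangle>\<close>, the inner product of \<open>\<psi> \<otimes> \<psi>\<close>.  Since
  \<^const>\<open>tensor_lift\<close> only extends bilinear maps, the extension in the antilinear first
  argument is that of the conjugate \<open>\<langle>c | a\<rangle> \<langle>d | b\<rangle>\<close>, conjugated afterwards.
\<close>

definition l2_tensor_inner ::
  "('b::cstar_algebra \<Rightarrow> complex) \<Rightarrow> ('b, 'b) tensor \<Rightarrow> ('b, 'b) tensor \<Rightarrow> complex" where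
  "l2_tensor_inner \<psi> s t =
     tensor_lift (\<lambda>c d. cnj (tensor_lift (\<lambda>a b. l2_inner \<psi> c a * l2_inner \<psi> d b) s)) t"

lemma l2_tensor_inner_pair:
  assumes "faithful_state \<psi>"
  shows "l2_tensor_inner \<psi> (a \<otimes> b) (c \<otimes> d) = l2_inner \<psi> a c * l2_inner \<psi> b d"
proof -
  have lin: "clinear \<psi>"
    using assms by (simp add: faithful_state_def)
  note ip = l2_inner_def clinear_add[OF lin] clinear_scale[OF lin] distrib_left distrib_right
    star_add star_scaleC mult_scaleC_left mult_scaleC_right
  have "cbilinear (\<lambda>a b. l2_inner \<psi> c a * l2_inner \<psi> d b)" for c d
    unfolding cbilinear_def by (auto intro!: clinearI simp: ip)
  then have "l2_tensor_inner \<psi> (a \<otimes> b) t =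
      tensor_lift (\<lambda>c d. cnj (l2_inner \<psi> c a * l2_inner \<psi> d b)) t" for t
    by (simp add: l2_tensor_inner_def tensor_lift_pair)
  moreover have "cbilinear (\<lambda>c d. cnj (l2_inner \<psi> c a * l2_inner \<psi> d b))"
    unfolding cbilinear_def by (auto intro!: clinearI simp: ip)
  ultimately show ?thesis
    by (simp add: tensor_lift_pair l2_inner_commute[OF assms, of c a]
        l2_inner_commute[OF assms, of d b])
qed

definition hilbert_adjoint ::
  "('x \<Rightarrow> 'x \<Rightarrow> complex) \<Rightarrow> ('y \<Rightarrow> 'y \<Rightarrow> complex) \<Rightarrow> ('x \<Rightarrow> 'y) \<Rightarrow> ('y \<Rightarrow> 'x)" where
  "hilbert_adjoint ip_dom ip_cod f = (SOME g. \<forall>x y. ip_cod (f x) y = ip_dom x (g y))"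

definition mult_map :: "('b::cstar_algebra, 'b) tensor \<Rightarrow> 'b" where
  "mult_map = tensor_lift (*)"

definition comult_map :: "('b::cstar_algebra \<Rightarrow> complex) \<Rightarrow> 'b \<Rightarrow> ('b, 'b) tensor" where
  "comult_map \<psi> = hilbert_adjoint (l2_tensor_inner \<psi>) (l2_inner \<psi>) mult_map"

definition l2_adjoint :: "('b::cstar_algebra \<Rightarrow> complex) \<Rightarrow> ('b \<Rightarrow> 'b) \<Rightarrow> 'b \<Rightarrow> 'b" where
  "l2_adjoint \<psi> = hilbert_adjoint (l2_inner \<psi>) (l2_inner \<psi>)"

definition quantum_set :: "('b::fd_cstar_algebra \<Rightarrow> complex) \<Rightarrow> real \<Rightarrow> bool" where
  "quantum_set \<psi> \<delta> \<longleftrightarrow> faithful_state \<psi> \<and> 0 \<le> \<delta>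
     \<and> (\<forall>x. mult_map (comult_map \<psi> x) = complex_of_real (\<delta>\<^sup>2) *\<^sub>C x)"

section \<open>Quantum graphs\<close>

definition schur_product ::
  "('b::fd_cstar_algebra \<Rightarrow> complex) \<Rightarrow> real \<Rightarrow> ('b \<Rightarrow> 'b) \<Rightarrow> ('b \<Rightarrow> 'b) \<Rightarrow> 'b \<Rightarrow> 'b" where
  "schur_product \<psi> \<delta> S T x =
     inverse (complex_of_real (\<delta>\<^sup>2)) *\<^sub>C mult_map (tensor_map S T (comult_map \<psi> x))"

definition involution_map :: "('b::cstar_algebra \<Rightarrow> 'b) \<Rightarrow> 'b \<Rightarrow> 'b" where
  "involution_map T x = star (T (star x))"

definition real_map :: "('b::cstar_algebra \<Rightarrow> 'b) \<Rightarrow> bool" where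
  "real_map T \<longleftrightarrow> involution_map T = T"

definition quantum_graph ::
  "('b::fd_cstar_algebra \<Rightarrow> complex) \<Rightarrow> real \<Rightarrow> ('b \<Rightarrow> 'b) \<Rightarrow> bool" where
  "quantum_graph \<psi> \<delta> A \<longleftrightarrow> quantum_set \<psi> \<delta> \<and> clinear A \<and> schur_product \<psi> \<delta> A A = A"

definition undirected :: "('b::cstar_algebra \<Rightarrow> complex) \<Rightarrow> ('b \<Rightarrow> 'b) \<Rightarrow> bool" where
  "undirected \<psi> A \<longleftrightarrow> real_map A \<and> A = l2_adjoint \<psi> A"

definition tracial :: "('b::cstar_algebra \<Rightarrow> complex) \<Rightarrow> bool" where
  "tracial \<psi> \<longleftrightarrow> (\<forall>x y. \<psi> (x * y) = \<psi> (y * x))"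

definition regular :: "('b::cstar_algebra \<Rightarrow> complex) \<Rightarrow> ('b \<Rightarrow> 'b) \<Rightarrow> complex \<Rightarrow> bool" where
  "regular \<psi> A d \<longleftrightarrow> A 1 = d *\<^sub>C 1 \<and> l2_adjoint \<psi> A 1 = d *\<^sub>C 1"

definition l2_norm :: "('b::cstar_algebra \<Rightarrow> complex) \<Rightarrow> 'b \<Rightarrow> real" where
  "l2_norm \<psi> x = sqrt (Re (l2_inner \<psi> x x))"

text \<open>
  As in \<^const>\<open>onorm\<close>; the quotient is \<open>0\<close> at \<open>x = 0\<close>.
\<close>

definition l2_op_norm :: "('b::cstar_algebra \<Rightarrow> complex) \<Rightarrow> ('b \<Rightarrow> 'b) \<Rightarrow> real" where
  "l2_op_norm \<psi> T = (SUP x. l2_norm \<psi> (T x) / l2_norm \<psi> x)"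

definition spec :: "('b::complex_vector \<Rightarrow> 'b) \<Rightarrow> complex set" where
  "spec T = {z. \<not> bij (\<lambda>x. T x - z *\<^sub>C x)}"

end

theory Submission
  imports Defs
begin

text \<open>
  In each of the three cases \<open>A\<close> is real, and a real Schur idempotent is completely positive.
  Indeed, let \<open>U\<close> be an orthonormal basis of \<open>L\<^sup>2(B, \<psi>)\<close>.  The adjoint of the multiplication is

    \<open>m\<^sup>\<dagger>(x\<^sup>* y) = \<Sum>u\<in>U. x\<^sup>* u \<otimes> u\<^sup>* y\<close>,

  a formula into which no modular automorphism of \<open>\<psi>\<close> enters (\<open>comult_map_expansion\<close>).
  Applying \<open>A \<bullet> A = A\<close> and the reality of \<open>A\<close> to it gives

    \<open>A(x\<^sup>* y) = \<delta>\<^sup>-\<^sup>2 \<Sum>u\<in>U. A(u\<^sup>* x)\<^sup>* A(u\<^sup>* y)\<close>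

  (\<open>schur_idempotent_gram\<close>), so \<open>(x, y) \<mapsto> A(x\<^sup>* y)\<close> is a positive form with values in \<open>B\<close>.
  Its value at \<open>x - 1 b\<close>, where the coefficient \<open>b\<close> acts from the right on the values, is
  positive; applying \<open>\<psi>\<close> yields the Schwarz inequality

    \<open>0 \<le> \<psi>(A(x\<^sup>* x) - A(x)\<^sup>* b - b\<^sup>* A(x) + b\<^sup>* A(1) b)\<close>

  (\<open>schur_idempotent_schwarz\<close>).

  For a regular graph \<open>A(1) = d 1\<close> forces \<open>d \<ge> 0\<close>, and the condition on the adjoint gives
  \<open>\<psi>(A(x\<^sup>* x)) = d \<psi>(x\<^sup>* x)\<close>.  If \<open>d > 0\<close>, then with \<open>b = A(x) / d\<close> the Schwarz inequality becomes
  \<open>\<parallel>A x\<parallel>\<^sup>2 \<le> d\<^sup>2 \<parallel>x\<parallel>\<^sup>2\<close> in \<open>L\<^sup>2\<close> (\<open>regular_contraction\<close>), and the bound is attained at \<open>1\<close>.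
  If \<open>d = 0\<close>, then \<open>b = A(x)\<close> shows that \<open>A = 0\<close>.
  In the undirected case \<open>A\<close> is self-adjoint; since the space is finite-dimensional, its
  spectrum consists of eigenvalues, which are real and bounded by the norm.
\<close>

section \<open>Linear extension on tensors\<close>

lemma clinear_sum: "clinear f \<Longrightarrow> f (\<Sum>i\<in>I. g i) = (\<Sum>i\<in>I. f (g i))"
  by (auto simp: Vector_Spaces.linear_def intro: module_hom.sum)

lemma cbilinear_simps:
  assumes "cbilinear \<beta>"
  shows "\<beta> (x + x') y = \<beta> x y + \<beta> x' y" "\<beta> x (y + y') = \<beta> x y + \<beta> x y'"
    "\<beta> (c *\<^sub>C x) y = c *\<^sub>C \<beta> x y" "\<beta> x (c *\<^sub>C y) = c *\<^sub>C \<beta> x y"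
  using assms clinear_add[of "\<lambda>x. \<beta> x y"] clinear_scale[of "\<lambda>x. \<beta> x y"]
    clinear_add[of "\<beta> x"] clinear_scale[of "\<beta> x"]
  by (auto simp: cbilinear_def)

lemma cbilinearI:
  assumes "\<And>x x' y. \<beta> (x + x') y = \<beta> x y + \<beta> x' y"
    and "\<And>x y y'. \<beta> x (y + y') = \<beta> x y + \<beta> x y'"
    and "\<And>c x y. \<beta> (c *\<^sub>C x) y = c *\<^sub>C \<beta> x y"
    and "\<And>c x y. \<beta> x (c *\<^sub>C y) = c *\<^sub>C \<beta> x y"
  shows "cbilinear \<beta>"
  unfolding cbilinear_def by (auto intro!: clinearI assms)

text \<open>
  Scalar multiples need no case of their own, since they are absorbed into the first factor of
  a pure tensor.
\<close>

lemma tensor_induct [case_names zero add pair]: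
  fixes t :: "('a::complex_vector, 'b::complex_vector) tensor"
  assumes zero: "P 0"
    and add: "\<And>s t. P s \<Longrightarrow> P t \<Longrightarrow> P (s + t)"
    and pair: "\<And>a b. P (a \<otimes> b)"
  shows "P t"
proof (induction t rule: tensor.abs_induct)
  case (1 p)
  show ?case
  proof (induction p rule: update_induct)
    case const
    then show ?case
      by (simp add: zero zero_tensor.abs_eq[symmetric])
  next
    case (update f k c)
    have "Poly_Mapping.update k c f = f + c *\<^sub>C free_pair (fst k) (snd k)"
      using update(1)
      by (intro poly_mapping_eqI)
        (auto simp: lookup_update lookup_add scaleC_poly_mapping.rep_eq lookup_single when_def
          in_keys_iff)
    then have "abs_tensor (Poly_Mapping.update k c f) = abs_tensor f + c *\<^sub>C (fst k \<otimes> snd k)"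
      by (simp add: tensor_pair.abs_eq scaleC_tensor.abs_eq plus_tensor.abs_eq)
    also have "c *\<^sub>C (fst k \<otimes> snd k) = (c *\<^sub>C fst k) \<otimes> snd k"
      by (simp add: cbilinear_simps(3)[OF cbilinear_tensor_pair])
    finally show ?case
      using update(3) by (simp add: add pair)
  qed
qed

lemma clinear_eq_on_pairs:
  assumes "clinear f" and "clinear g" and "\<And>a b. f (a \<otimes> b) = g (a \<otimes> b)"
  shows "f t = g t"
  using assms
  by (induction t rule: tensor_induct) (simp_all add: clinear_zero clinear_add)

lemma tensor_map_pair:
  assumes "clinear S" and "clinear T"
  shows "tensor_map S T (a \<otimes> b) = S a \<otimes> T b"
proof -
  have "cbilinear (\<lambda>a b. S a \<otimes> T b)"
    by (rule cbilinearI)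
      (simp_all add: clinear_add[OF assms(1)] clinear_add[OF assms(2)]
        clinear_scale[OF assms(1)] clinear_scale[OF assms(2)]
        cbilinear_simps[OF cbilinear_tensor_pair])
  then show ?thesis
    by (simp add: tensor_map_def tensor_lift_pair)
qed

lemma clinear_tensor_map: "clinear (tensor_map S T)"
  unfolding tensor_map_def by (rule clinear_tensor_lift)

lemma mult_map_pair: "mult_map (a \<otimes> b) = a * (b :: 'b::cstar_algebra)"
proof -
  have "cbilinear ((*) :: 'b \<Rightarrow> 'b \<Rightarrow> 'b)"
    by (rule cbilinearI) (simp_all add: algebra_simps mult_scaleC_left mult_scaleC_right)
  then show ?thesis
    by (simp add: mult_map_def tensor_lift_pair)
qed

lemma clinear_mult_map: "clinear mult_map"
  unfolding mult_map_def by (rule clinear_tensor_lift)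

section \<open>The Hilbert space of a faithful state\<close>

lemma star_zero: "star (0 :: 'b::cstar_algebra) = 0"
  using star_add[of "0 :: 'b" 0] by simp

lemma star_one: "star (1 :: 'b::cstar_algebra) = 1"
  by (metis mult_1 mult_1_right star_mult star_star)

lemma star_diff: "star (x - y) = star x - star (y :: 'b::cstar_algebra)"
  by (metis add_diff_cancel diff_add_cancel star_add)

lemma star_sum: "star (\<Sum>i\<in>I. f i) = (\<Sum>i\<in>I. star (f i :: 'b::cstar_algebra))"
  by (induction I rule: infinite_finite_induct) (simp_all add: star_zero star_add)

context
  fixes \<psi> :: "'b::fd_cstar_algebra \<Rightarrow> complex"
  assumes state: "faithful_state \<psi>"
begin

lemma clinear_state: "clinear \<psi>"
  using state by (simp add: faithful_state_def)

lemmas state_simps = clinear_add[OF clinear_state] clinear_scale[OF clinear_state]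
  clinear_diff[OF clinear_state] clinear_zero[OF clinear_state] clinear_sum[OF clinear_state]

lemmas inner_commute = l2_inner_commute[OF state]

lemma state_nonneg: "0 \<le> Re (\<psi> (star x * x))"
  using state by (simp add: faithful_state_def)

lemma clinear_inner: "clinear (l2_inner \<psi> x)"
  by (rule clinearI) (simp_all add: l2_inner_def distrib_left mult_scaleC_right state_simps)

lemmas inner_right_simps = clinear_add[OF clinear_inner] clinear_scale[OF clinear_inner]
  clinear_diff[OF clinear_inner] clinear_zero[OF clinear_inner] clinear_sum[OF clinear_inner]

lemma inner_add_left: "l2_inner \<psi> (x + y) z = l2_inner \<psi> x z + l2_inner \<psi> y z"
  by (simp add: l2_inner_def star_add distrib_right state_simps)

lemma inner_scale_left: "l2_inner \<psi> (c *\<^sub>C x) z = cnj c * l2_inner \<psi> x z"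
  by (simp add: l2_inner_def star_scaleC mult_scaleC_left state_simps)

lemma inner_sum_left: "l2_inner \<psi> (\<Sum>i\<in>I. f i) z = (\<Sum>i\<in>I. l2_inner \<psi> (f i) z)"
  by (simp add: l2_inner_def star_sum sum_distrib_right state_simps)

lemma l2_norm_power2: "(l2_norm \<psi> x)\<^sup>2 = Re (\<psi> (star x * x))"
  by (simp add: l2_norm_def l2_inner_def state_nonneg)

lemma inner_self: "l2_inner \<psi> x x = complex_of_real ((l2_norm \<psi> x)\<^sup>2)"
  using state
  by (simp add: l2_norm_power2 l2_inner_def faithful_state_def complex_is_Real_iff complex_eq_iff)

lemma l2_norm_nonneg: "0 \<le> l2_norm \<psi> x"
  by (simp add: l2_norm_def l2_inner_def state_nonneg)

lemma l2_norm_eq_0: "l2_norm \<psi> x = 0 \<Longrightarrow> x = 0"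
  using inner_self[of x] state by (simp add: l2_inner_def faithful_state_def)

lemma l2_norm_one: "l2_norm \<psi> 1 = 1"
  using state by (simp add: l2_norm_def l2_inner_def star_one faithful_state_def)

lemma l2_norm_scale: "l2_norm \<psi> (c *\<^sub>C x) = cmod c * l2_norm \<psi> x"
proof -
  have "complex_of_real ((l2_norm \<psi> (c *\<^sub>C x))\<^sup>2) = cnj c * c * l2_inner \<psi> x x"
    by (simp only: inner_self[symmetric] inner_scale_left inner_right_simps scaleC_complex_def
        mult_ac)
  also have "\<dots> = complex_of_real ((cmod c * l2_norm \<psi> x)\<^sup>2)"
    using complex_norm_square[of c] by (simp add: inner_self power_mult_distrib mult.commute)
  finally have "(l2_norm \<psi> (c *\<^sub>C x))\<^sup>2 = (cmod c * l2_norm \<psi> x)\<^sup>2"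
    by (simp only: of_real_eq_iff)
  then show ?thesis
    by (simp add: l2_norm_nonneg)
qed

definition orthonormal :: "'b set \<Rightarrow> bool" where
  "orthonormal U \<longleftrightarrow> (\<forall>u\<in>U. \<forall>v\<in>U. l2_inner \<psi> u v = (if u = v then 1 else 0))"

text \<open>
  The finite orthonormal bases are the typical examples.  The reconstruction formula is their only
  property that the computation of adjoints below relies on.
\<close>

definition parseval_frame :: "'b set \<Rightarrow> bool" where
  "parseval_frame U \<longleftrightarrow> finite U \<and> (\<forall>x. (\<Sum>u\<in>U. l2_inner \<psi> u x *\<^sub>C u) = x)"

lemma gram_schmidt:
  assumes "finite S"
  shows "\<exists>U. finite U \<and> orthonormal U \<and> S \<subseteq> complex_vector.span U"
  using assms
proof (induction S)
  case empty
  show ?case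
    by (rule exI[of _ "{}"]) (simp add: orthonormal_def)
next
  case (insert x S)
  then obtain U where U: "finite U" "orthonormal U" "S \<subseteq> complex_vector.span U"
    by blast
  define p where "p = (\<Sum>u\<in>U. l2_inner \<psi> u x *\<^sub>C u)"
  have p: "p \<in> complex_vector.span U"
    unfolding p_def
    by (intro complex_vector.span_sum complex_vector.span_scale complex_vector.span_base)
  show ?case
  proof (cases "x = p")
    case True
    with U p show ?thesis by blast
  next
    case False
    define n where "n = l2_norm \<psi> (x - p)"
    define e where "e = inverse (complex_of_real n) *\<^sub>C (x - p)"
    have n: "n \<noteq> 0"
      using False l2_norm_eq_0[of "x - p"] by (auto simp: n_def)
    have up: "l2_inner \<psi> u e = 0" if "u \<in> U" for u
    proof -
      have "l2_inner \<psi> u p = (\<Sum>v\<in>U. if v = u then l2_inner \<psi> v x else 0)"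
        unfolding p_def inner_right_simps
        using U(2) that by (intro sum.cong) (auto simp: orthonormal_def)
      then show ?thesis
        using U(1) that by (simp add: e_def inner_right_simps)
    qed
    have ee: "l2_inner \<psi> e e = 1"
    proof -
      have "l2_norm \<psi> e = 1"
        using n l2_norm_nonneg[of "x - p"]
        by (simp add: e_def l2_norm_scale n_def[symmetric] norm_inverse)
      then show ?thesis
        by (simp add: inner_self)
    qed
    have ev: "l2_inner \<psi> e u = 0" if "u \<in> U" for u
      using up[OF that] inner_commute[of e u] by simp
    have "orthonormal (insert e U)"
      using U(2) up ev ee by (auto simp: orthonormal_def)
    moreover have "x \<in> complex_vector.span (insert e U)"
    proof -
      have "x = complex_of_real n *\<^sub>C e + p"
        using n by (simp add: e_def scaleC_scaleC scaleC_one)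
      moreover have "complex_of_real n *\<^sub>C e \<in> complex_vector.span (insert e U)"
        by (intro complex_vector.span_scale complex_vector.span_base) simp
      moreover have "p \<in> complex_vector.span (insert e U)"
        using p complex_vector.span_mono[of U "insert e U"] by blast
      ultimately show ?thesis
        by (metis complex_vector.span_add)
    qed
    moreover have "S \<subseteq> complex_vector.span (insert e U)"
      using U(3) complex_vector.span_mono[of U "insert e U"] by blast
    ultimately show ?thesis
      using U(1) by (intro exI[of _ "insert e U"]) simp
  qed
qed

lemma finite_spanning_set:
  "\<exists>S :: 'b set. finite S \<and> complex_vector.span S = UNIV"
proof -
  obtain S :: "'b set" where S: "finite S" "\<And>x. \<exists>c. x = (\<Sum>b\<in>S. c b *\<^sub>C b)"
    using finite_dimensional by blast
  have "x \<in> complex_vector.span S" for x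
  proof -
    obtain c where x: "x = (\<Sum>b\<in>S. c b *\<^sub>C b)"
      using S(2) by blast
    show ?thesis
      unfolding x
      by (intro complex_vector.span_sum complex_vector.span_scale complex_vector.span_base)
  qed
  with S(1) show ?thesis by blast
qed

lemma parseval_frame_exists: "\<exists>U. parseval_frame U"
proof -
  obtain S :: "'b set" where S: "finite S" "complex_vector.span S = UNIV"
    using finite_spanning_set by blast
  obtain U where U: "finite U" "orthonormal U" "S \<subseteq> complex_vector.span U"
    using gram_schmidt[OF S(1)] by blast
  have "complex_vector.span U = UNIV"
    using complex_vector.span_minimal[OF U(3) complex_vector.subspace_span] S(2) by blast
  have "(\<Sum>u\<in>U. l2_inner \<psi> u x *\<^sub>C u) = x" for x
  proof -
    have "x \<in> complex_vector.span U"
      using \<open>complex_vector.span U = UNIV\<close> by simp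
    then show ?thesis
    proof (induction rule: complex_vector.span_induct_alt)
      case base
      show ?case by (simp add: inner_right_simps)
    next
      case (step c v y)
      have "(\<Sum>u\<in>U. l2_inner \<psi> u v *\<^sub>C u) = (\<Sum>u\<in>U. if u = v then v else 0)"
        using U(2) step(1) by (intro sum.cong) (auto simp: orthonormal_def scaleC_one)
      also have "\<dots> = v"
        using U(1) step(1) by simp
      finally have "(\<Sum>u\<in>U. l2_inner \<psi> u (c *\<^sub>C v) *\<^sub>C u) = c *\<^sub>C v"
        by (simp only: inner_right_simps(2) scaleC_complex_def scaleC_scaleC[symmetric]
            complex_vector.scale_sum_right[symmetric])
      with step(2) show ?case
        by (simp add: inner_right_simps(1) scaleC_add_left sum.distrib)
    qed
  qed
  with U(1) show ?thesis
    by (auto simp: parseval_frame_def)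
qed

text \<open>
  The adjoint is a choice among the maps with the adjoint property; in finite dimension one
  exists, namely \<open>y \<mapsto> \<Sum>u. \<langle>T u | y\<rangle> u\<close>.
\<close>

lemma hilbert_adjoint_inner:
  assumes "clinear T"
  shows "l2_inner \<psi> (T x) y = l2_inner \<psi> x (l2_adjoint \<psi> T y)"
proof -
  obtain U where U: "parseval_frame U"
    using parseval_frame_exists by blast
  let ?g = "\<lambda>y. \<Sum>u\<in>U. l2_inner \<psi> (T u) y *\<^sub>C u"
  have adj: "l2_inner \<psi> (T x) y = l2_inner \<psi> x (?g y)" for x y
  proof -
    have "T x = T (\<Sum>u\<in>U. l2_inner \<psi> u x *\<^sub>C u)"
      using U by (simp add: parseval_frame_def)
    then have "T x = (\<Sum>u\<in>U. l2_inner \<psi> u x *\<^sub>C T u)"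
      by (simp only: clinear_sum[OF assms] clinear_scale[OF assms])
    then have "l2_inner \<psi> (T x) y = (\<Sum>u\<in>U. cnj (l2_inner \<psi> u x) * l2_inner \<psi> (T u) y)"
      by (simp only: inner_sum_left inner_scale_left)
    also have "\<dots> = (\<Sum>u\<in>U. l2_inner \<psi> (T u) y * l2_inner \<psi> x u)"
      by (simp only: inner_commute[symmetric] mult.commute)
    also have "\<dots> = l2_inner \<psi> x (?g y)"
      by (simp only: inner_right_simps scaleC_complex_def)
    finally show ?thesis .
  qed
  have "\<forall>x y. l2_inner \<psi> (T x) y = l2_inner \<psi> x (?g y)"
    by (intro allI adj)
  then have "\<forall>x y. l2_inner \<psi> (T x) y = l2_inner \<psi> x (l2_adjoint \<psi> T y)"
    unfolding l2_adjoint_def hilbert_adjoint_def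
    by (rule someI[of "\<lambda>g. \<forall>x y. l2_inner \<psi> (T x) y = l2_inner \<psi> x (g y)"])
  then show ?thesis
    by simp
qed

section \<open>Comultiplication in a Parseval frame\<close>

text \<open>
  The integrand that defines the inner product on tensors is bilinear for every left argument,
  so that its lift is the intended extension and not the dummy value of \<^const>\<open>tensor_lift\<close>.
\<close>

lemma cbilinear_tensor_inner_kernel:
  "cbilinear (\<lambda>c d. cnj (tensor_lift (\<lambda>a b. l2_inner \<psi> c a * l2_inner \<psi> d b) s))"
proof (induction s rule: tensor_induct)
  case zero
  show ?case
    by (rule cbilinearI) (simp_all add: clinear_zero[OF clinear_tensor_lift])
next
  case (add s t)
  show ?case
    by (rule cbilinearI)
      (simp_all add: clinear_add[OF clinear_tensor_lift] cbilinear_simps[OF add(1)]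
        cbilinear_simps[OF add(2)] distrib_left add_ac)
next
  case (pair a b)
  have "cbilinear (\<lambda>a b. l2_inner \<psi> c a * l2_inner \<psi> d b)" for c d
    by (rule cbilinearI) (simp_all add: inner_right_simps algebra_simps)
  note lift = tensor_lift_pair[OF this]
  show ?case
    unfolding lift
    by (rule cbilinearI) (simp_all add: inner_add_left inner_scale_left algebra_simps)
qed

lemma clinear_tensor_inner: "clinear (l2_tensor_inner \<psi> s)"
  unfolding l2_tensor_inner_def by (rule clinear_tensor_lift)

lemma clinear_cnj_tensor_inner_pair: "clinear (\<lambda>s. cnj (l2_tensor_inner \<psi> s (c \<otimes> d)))"
proof -
  have "cnj (l2_tensor_inner \<psi> s (c \<otimes> d)) =
      tensor_lift (\<lambda>a b. l2_inner \<psi> c a * l2_inner \<psi> d b) s" for s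
    unfolding l2_tensor_inner_def tensor_lift_pair[OF cbilinear_tensor_inner_kernel] by simp
  then show ?thesis
    by (simp add: clinear_tensor_lift)
qed

lemma tensor_expansion:
  assumes "parseval_frame U"
  shows "(\<Sum>u\<in>U. \<Sum>v\<in>U. l2_tensor_inner \<psi> (u \<otimes> v) s *\<^sub>C (u \<otimes> v)) = s"
proof (rule clinear_eq_on_pairs[where g = "\<lambda>s. s"])
  show "clinear (\<lambda>s. \<Sum>u\<in>U. \<Sum>v\<in>U. l2_tensor_inner \<psi> (u \<otimes> v) s *\<^sub>C (u \<otimes> v))"
    by (rule clinearI)
      (simp_all add: clinear_add[OF clinear_tensor_inner] clinear_scale[OF clinear_tensor_inner]
        scaleC_add_left sum.distrib complex_vector.scale_sum_right scaleC_scaleC)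
  show "clinear (\<lambda>s :: ('b, 'b) tensor. s)"
    by (rule clinearI) simp_all
  fix a b
  have lin: "clinear (\<lambda>x. x \<otimes> y)" "clinear ((\<otimes>) x)" for x y :: 'b
    using cbilinear_tensor_pair by (auto simp: cbilinear_def)
  have "a \<otimes> b = (\<Sum>u\<in>U. l2_inner \<psi> u a *\<^sub>C u) \<otimes> (\<Sum>v\<in>U. l2_inner \<psi> v b *\<^sub>C v)"
    using assms by (simp add: parseval_frame_def)
  also have "\<dots> = (\<Sum>u\<in>U. l2_inner \<psi> u a *\<^sub>C (u \<otimes> (\<Sum>v\<in>U. l2_inner \<psi> v b *\<^sub>C v)))"
    by (simp only: clinear_sum[OF lin(1)] clinear_scale[OF lin(1)])
  also have "\<dots> = (\<Sum>u\<in>U. \<Sum>v\<in>U. l2_tensor_inner \<psi> (u \<otimes> v) (a \<otimes> b) *\<^sub>C (u \<otimes> v))"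
    by (simp only: clinear_sum[OF lin(2)] clinear_scale[OF lin(2)] scaleC_scaleC
        l2_tensor_inner_pair[OF state] complex_vector.scale_sum_right)
  finally show "(\<Sum>u\<in>U. \<Sum>v\<in>U. l2_tensor_inner \<psi> (u \<otimes> v) (a \<otimes> b) *\<^sub>C (u \<otimes> v)) = a \<otimes> b"
    by (rule sym)
qed

text \<open>Nondegeneracy makes the comultiplication unique, hence computable despite being a choice.\<close>

lemma tensor_inner_nondegenerate:
  assumes "\<And>t. l2_tensor_inner \<psi> t s = l2_tensor_inner \<psi> t s'"
  shows "s = s'"
proof -
  obtain U where U: "parseval_frame U"
    using parseval_frame_exists by blast
  have "s = (\<Sum>u\<in>U. \<Sum>v\<in>U. l2_tensor_inner \<psi> (u \<otimes> v) s *\<^sub>C (u \<otimes> v))"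
    by (rule tensor_expansion[OF U, symmetric])
  also have "\<dots> = s'"
    unfolding assms by (rule tensor_expansion[OF U])
  finally show ?thesis .
qed

text \<open>
  Pairing the right-hand side with \<open>a \<otimes> b\<close> gives
  \<open>\<Sum>u. \<langle>u | x a\<rangle> \<psi>(y\<^sup>* u b)\<close>, which is \<open>\<psi>(y\<^sup>* x a b) = \<langle>x\<^sup>* y | a b\<rangle>\<close> by expanding \<open>x a\<close> in the
  frame.  Splitting the argument as \<open>x\<^sup>* y\<close> makes the symmetry between the two legs visible:
  the first leg \<open>x\<^sup>* u\<close> is the star of \<open>u\<^sup>* x\<close>, the second leg for \<open>x\<close> in place of \<open>y\<close>.
\<close>

lemma comult_map_expansion:
  assumes U: "parseval_frame U"
  shows "comult_map \<psi> (star x * y) = (\<Sum>u\<in>U. (star x * u) \<otimes> (star u * y))"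
proof -
  have adj: "l2_inner \<psi> (mult_map t) (star x * y) =
      l2_tensor_inner \<psi> t (\<Sum>u\<in>U. (star x * u) \<otimes> (star u * y))" for t x y
  proof -
    \<comment> \<open>Both sides are antilinear in \<open>t\<close>; conjugation makes them linear.\<close>
    let ?f = "\<lambda>t. cnj (l2_inner \<psi> (mult_map t) (star x * y))"
    let ?g = "\<lambda>t. cnj (l2_tensor_inner \<psi> t (\<Sum>u\<in>U. (star x * u) \<otimes> (star u * y)))"
    have "?f t = ?g t"
    proof (rule clinear_eq_on_pairs[where f = ?f and g = ?g])
      show "clinear ?f"
        by (rule clinearI)
          (simp_all add: clinear_add[OF clinear_mult_map] clinear_scale[OF clinear_mult_map]
            inner_add_left inner_scale_left)
      show "clinear ?g"
        by (rule clinearI)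
          (simp_all add: clinear_sum[OF clinear_tensor_inner] sum.distrib sum_distrib_left
            clinear_add[OF clinear_cnj_tensor_inner_pair, simplified]
            clinear_scale[OF clinear_cnj_tensor_inner_pair, simplified])
      fix a b
      have "star y * (x * a) * b = star y * (\<Sum>u\<in>U. l2_inner \<psi> u (x * a) *\<^sub>C u) * b"
        using U by (simp add: parseval_frame_def)
      also have "\<dots> = (\<Sum>u\<in>U. l2_inner \<psi> u (x * a) *\<^sub>C (star y * u * b))"
        by (simp only: sum_distrib_left sum_distrib_right mult_scaleC_left mult_scaleC_right)
      finally have "\<psi> (star y * (x * a) * b) =
          (\<Sum>u\<in>U. l2_inner \<psi> u (x * a) * \<psi> (star y * u * b))"
        by (simp add: state_simps)
      then have "l2_inner \<psi> (star x * y) (a * b) =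
          (\<Sum>u\<in>U. l2_inner \<psi> (star x * u) a * l2_inner \<psi> (star u * y) b)"
        by (simp add: l2_inner_def star_mult star_star mult.assoc)
      then show "?f (a \<otimes> b) = ?g (a \<otimes> b)"
        by (simp add: mult_map_pair clinear_sum[OF clinear_tensor_inner]
            l2_tensor_inner_pair[OF state] inner_commute[symmetric])
    qed
    then show ?thesis by simp
  qed
  let ?P = "\<lambda>g. \<forall>t z. l2_inner \<psi> (mult_map t) z = l2_tensor_inner \<psi> t (g z)"
  have "?P (\<lambda>z. \<Sum>u\<in>U. u \<otimes> (star u * z))"
    using adj[where x = 1] unfolding star_one mult_1_left by blast
  then have "?P (comult_map \<psi>)"
    unfolding comult_map_def hilbert_adjoint_def by (rule someI[of ?P])
  then have "l2_tensor_inner \<psi> t (comult_map \<psi> (star x * y)) =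
      l2_inner \<psi> (mult_map t) (star x * y)" for t
    by simp
  then show ?thesis
    unfolding adj by (rule tensor_inner_nondegenerate)
qed

section \<open>Real Schur idempotents satisfy the Schwarz inequality\<close>

text \<open>
  Reality turns the first leg of the comultiplication into the star of the second one, so the
  Schur square of \<open>A\<close> is a sum of Gram terms: this is complete positivity of \<open>A\<close>.
\<close>

lemma schur_idempotent_gram:
  assumes U: "parseval_frame U" and lin: "clinear A"
    and idem: "schur_product \<psi> \<delta> A A = A" and real: "real_map A"
  shows "A (star x * y) = inverse (complex_of_real (\<delta>\<^sup>2)) *\<^sub>C
    (\<Sum>u\<in>U. star (A (star u * x)) * A (star u * y))"
proof -
  have "A (star x * u) = star (A (star u * x))" for u
    using fun_cong[OF real[unfolded real_map_def], of "star x * u"]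
    by (simp add: involution_map_def star_mult star_star)
  moreover have "A (star x * y) = schur_product \<psi> \<delta> A A (star x * y)"
    by (simp add: idem)
  ultimately show ?thesis
    by (simp add: schur_product_def comult_map_expansion[OF U] clinear_sum[OF clinear_tensor_map]
        clinear_sum[OF clinear_mult_map] tensor_map_pair[OF lin lin] mult_map_pair)
qed

text \<open>
  The vectors \<open>\<xi>\<^sub>u(x) = A(u\<^sup>* x)\<close> represent the form \<open>A(x\<^sup>* y)\<close>; the expression below is, up to a
  nonnegative factor, the value under \<open>\<psi>\<close> of the square sum of \<open>\<xi>\<^sub>u(x) - \<xi>\<^sub>u(1) b\<close>.
\<close>

lemma schur_idempotent_schwarz:
  assumes lin: "clinear A" and idem: "schur_product \<psi> \<delta> A A = A" and real: "real_map A"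
  shows "0 \<le> Re (\<psi> (A (star x * x) - star (A x) * b - star b * A x + star b * A 1 * b))"
proof -
  obtain U where U: "parseval_frame U"
    using parseval_frame_exists by blast
  define \<kappa> where "\<kappa> = inverse (\<delta>\<^sup>2)"
  note gram = schur_idempotent_gram[OF U lin idem real]
  define S where "S x y = (\<Sum>u\<in>U. star (A (star u * x)) * A (star u * y))" for x y
  have A_S: "A (star x * y) = complex_of_real \<kappa> *\<^sub>C S x y" for x y
    using gram[of x y] by (simp add: S_def \<kappa>_def)
  define \<xi> where "\<xi> u = A (star u * x) - A (star u) * b" for u
  have "(\<Sum>u\<in>U. star (\<xi> u) * \<xi> u) = S x x - S x 1 * b - star b * S 1 x + star b * S 1 1 * b"
    by (simp add: \<xi>_def S_def star_diff star_mult algebra_simps sum.distrib sum_subtractf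
        sum_distrib_left sum_distrib_right)
  then have "complex_of_real \<kappa> *\<^sub>C (\<Sum>u\<in>U. star (\<xi> u) * \<xi> u) =
      A (star x * x) - A (star x * 1) * b - star b * A (star 1 * x) + star b * A (star 1 * 1) * b"
    by (simp only: A_S complex_vector.scale_right_diff_distrib scaleC_add_right mult_scaleC_left
        mult_scaleC_right)
  also have "\<dots> = A (star x * x) - star (A x) * b - star b * A x + star b * A 1 * b"
    using fun_cong[OF real[unfolded real_map_def], of "star x"]
    by (simp add: involution_map_def star_star star_one)
  finally have "Re (\<psi> (A (star x * x) - star (A x) * b - star b * A x + star b * A 1 * b)) =
      Re (\<psi> (complex_of_real \<kappa> *\<^sub>C (\<Sum>u\<in>U. star (\<xi> u) * \<xi> u)))"
    by simp
  also have "\<dots> = \<kappa> * (\<Sum>u\<in>U. Re (\<psi> (star (\<xi> u) * \<xi> u)))"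
    by (simp add: state_simps)
  also have "0 \<le> \<dots>"
    by (simp add: \<kappa>_def sum_nonneg state_nonneg)
  finally show ?thesis .
qed

section \<open>Regular quantum graphs\<close>

text \<open>
  Reality at \<open>1\<close> makes \<open>d\<close> real; positivity of \<open>A(1)\<close>, the Schwarz inequality with \<open>b = 0\<close>,
  makes it nonnegative.
\<close>

lemma regular_degree_nonneg:
  assumes lin: "clinear A" and idem: "schur_product \<psi> \<delta> A A = A" and real: "real_map A"
    and reg: "A 1 = d *\<^sub>C 1"
  shows "d = complex_of_real (Re d)" and "0 \<le> Re d"
proof -
  have one: "\<psi> 1 = 1"
    using state by (simp add: faithful_state_def)
  have "\<psi> (star (A 1)) = \<psi> (A 1)"
    using fun_cong[OF real[unfolded real_map_def], of 1]
    by (simp add: involution_map_def star_one)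
  then have "cnj d = d"
    by (simp add: reg faithful_state_star[OF state] state_simps one)
  then show "d = complex_of_real (Re d)"
    by (simp add: complex_eq_iff)
  show "0 \<le> Re d"
    using schur_idempotent_schwarz[OF lin idem real, of 1 0]
    by (simp add: star_one star_zero reg state_simps one)
qed

text \<open>
  The Schwarz inequality with \<open>b = t A(x)\<close> is a quadratic inequality in the real number \<open>t\<close>
  whose leading coefficient and constant term both carry the degree: the former through
  \<open>A(1)\<close>, the latter because the condition on the adjoint makes \<open>\<psi>\<close> an eigenfunctional,
  \<open>\<psi>(A y) = d \<psi>(y)\<close>.
\<close>

lemma regular_contraction:
  assumes lin: "clinear A" and idem: "schur_product \<psi> \<delta> A A = A" and real: "real_map A"
    and reg: "regular \<psi> A d"
  shows "l2_norm \<psi> (A x) \<le> Re d * l2_norm \<psi> x"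
proof -
  have A1: "A 1 = d *\<^sub>C 1" and adj1: "l2_adjoint \<psi> A 1 = d *\<^sub>C 1"
    using reg by (auto simp: regular_def)
  obtain r where d: "d = complex_of_real r" and r: "0 \<le> r"
    using regular_degree_nonneg[OF lin idem real A1] by metis
  let ?N = "(l2_norm \<psi> (A x))\<^sup>2" and ?M = "(l2_norm \<psi> x)\<^sup>2"
  have "\<psi> (A y) = d * \<psi> y" for y
  proof -
    have "\<psi> (star (A y)) = d * \<psi> (star y)"
      using hilbert_adjoint_inner[OF lin, of y 1]
      by (simp add: adj1 l2_inner_def mult_scaleC_right state_simps)
    then have "cnj (\<psi> (A y)) = cnj (d * \<psi> y)"
      unfolding faithful_state_star[OF state] by (simp add: d)
    then show ?thesis
      by (simp only: complex_cnj_cancel_iff)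
  qed
  then have quad: "0 \<le> r * ?M - 2 * t * ?N + t\<^sup>2 * r * ?N" for t
    using schur_idempotent_schwarz[OF lin idem real, of x "complex_of_real t *\<^sub>C A x"]
    unfolding l2_norm_power2
    by (simp add: A1 d star_scaleC mult_scaleC_left mult_scaleC_right state_simps
        power2_eq_square algebra_simps)
  have "?N \<le> r\<^sup>2 * ?M"
  \<comment> \<open>The optimal \<open>t\<close> is \<open>1 / r\<close>; for \<open>r = 0\<close> any positive \<open>t\<close> forces \<open>A x\<close> to vanish.\<close>
  proof (cases "r = 0")
    case True
    with quad[of 1] show ?thesis by simp
  next
    case False
    have "0 \<le> r * ?M - ?N / r"
      using quad[of "1 / r"] False by (simp add: power2_eq_square field_simps)
    then have "0 \<le> r * (r * ?M - ?N / r)"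
      using r by simp
    with False show ?thesis
      by (simp add: power2_eq_square algebra_simps)
  qed
  then have "?N \<le> (r * l2_norm \<psi> x)\<^sup>2"
    by (simp add: power_mult_distrib)
  then have "l2_norm \<psi> (A x) \<le> r * l2_norm \<psi> x"
    by (rule power2_le_imp_le) (simp add: r l2_norm_nonneg)
  then show ?thesis
    by (simp add: d)
qed

text \<open>The supremum is a maximum, attained at the unit.\<close>

lemma l2_op_norm_eqI:
  assumes "\<And>x. l2_norm \<psi> (T x) \<le> r * l2_norm \<psi> x" and "T 1 = complex_of_real r *\<^sub>C 1"
    and "0 \<le> r"
  shows "l2_op_norm \<psi> T = r"
  unfolding l2_op_norm_def
proof (rule cSup_eq_maximum)
  have "r = l2_norm \<psi> (T 1) / l2_norm \<psi> 1"
    unfolding assms(2) l2_norm_scale l2_norm_one using assms(3) by simp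
  then show "r \<in> range (\<lambda>x. l2_norm \<psi> (T x) / l2_norm \<psi> x)"
    by (rule image_eqI) simp
  fix q
  assume "q \<in> range (\<lambda>x. l2_norm \<psi> (T x) / l2_norm \<psi> x)"
  then obtain x where q: "q = l2_norm \<psi> (T x) / l2_norm \<psi> x"
    by blast
  show "q \<le> r"
    using assms(1)[of x] assms(3) l2_norm_nonneg[of x]
    by (cases "l2_norm \<psi> x = 0") (simp_all add: q divide_le_eq)
qed

text \<open>In finite dimension an injective endomorphism is bijective.\<close>

lemma spec_eigenvector:
  fixes T :: "'b \<Rightarrow> 'b"
  assumes lin: "clinear T" and z: "z \<in> spec T"
  obtains x where "x \<noteq> 0" and "T x = z *\<^sub>C x"
proof -
  let ?f = "\<lambda>x. T x - z *\<^sub>C x"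
  have f: "clinear ?f"
    by (rule clinearI)
      (simp_all add: clinear_add[OF lin] clinear_scale[OF lin] scaleC_add_right
        complex_vector.scale_right_diff_distrib scaleC_scaleC mult.commute)
  obtain S :: "'b set" where S: "finite S" "complex_vector.span S = UNIV"
    using finite_spanning_set by blast
  obtain B where B: "B \<subseteq> S" "complex_vector.independent B" "S \<subseteq> complex_vector.span B"
    using complex_vector.maximal_independent_subset[of S] by blast
  have span: "complex_vector.span B = UNIV"
    using complex_vector.span_minimal[OF B(3) complex_vector.subspace_span] S(2) by blast
  interpret fd: finite_dimensional_vector_space "scaleC :: complex \<Rightarrow> 'b \<Rightarrow> 'b" B
    using B span S(1) by unfold_locales (auto intro: finite_subset)
  have "\<not> inj ?f"
    using z fd.linear_inj_imp_surj[OF f] by (auto simp: spec_def bij_def)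
  then obtain x y where "x \<noteq> y" "?f x = ?f y"
    by (auto simp: inj_on_def)
  then have "?f (x - y) = 0" "x - y \<noteq> 0"
    by (simp_all add: clinear_diff[OF f])
  then show ?thesis
    by (intro that[of "x - y"]) simp_all
qed

lemma selfadjoint_spec_bounded:
  assumes lin: "clinear T" and selfadj: "T = l2_adjoint \<psi> T"
    and bound: "\<And>x. l2_norm \<psi> (T x) \<le> r * l2_norm \<psi> x"
  shows "spec T \<subseteq> complex_of_real ` {- r .. r}"
proof
  fix z
  assume "z \<in> spec T"
  then obtain x where x: "x \<noteq> 0" "T x = z *\<^sub>C x"
    by (rule spec_eigenvector[OF lin])
  have pos: "0 < l2_norm \<psi> x"
    using x(1) l2_norm_eq_0[of x] l2_norm_nonneg[of x] by fastforce
  have "l2_inner \<psi> (T x) x = l2_inner \<psi> x (T x)"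
    using hilbert_adjoint_inner[OF lin, of x x] selfadj by simp
  then have "cnj z = z"
    using pos by (simp add: x(2) inner_scale_left inner_right_simps inner_self)
  then have "z = complex_of_real (Re z)"
    by (simp add: complex_eq_iff)
  moreover have "cmod z \<le> r"
    using bound[of x] pos by (simp add: x(2) l2_norm_scale)
  then have "Re z \<in> {- r .. r}"
    using abs_Re_le_cmod[of z] by auto
  ultimately show "z \<in> complex_of_real ` {- r .. r}"
    by blast
qed

end

theorem theorem2p11:
  fixes \<psi> :: "'b::fd_cstar_algebra \<Rightarrow> complex" and \<delta> :: real
    and A :: "'b \<Rightarrow> 'b" and d :: complex
  assumes "quantum_graph \<psi> \<delta> A" and "regular \<psi> A d"
  shows "(undirected \<psi> A \<or> (real_map A \<and> real_map (l2_adjoint \<psi> A)) \<or> (real_map A \<and> tracial \<psi>)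
           \<longrightarrow> complex_of_real (l2_op_norm \<psi> A) = d)
       \<and> (undirected \<psi> A \<longrightarrow> spec A \<subseteq> complex_of_real ` {- Re d .. Re d})"
proof -
  have state: "faithful_state \<psi>" and lin: "clinear A" and idem: "schur_product \<psi> \<delta> A A = A"
    using assms(1) by (auto simp: quantum_graph_def quantum_set_def)
  have A1: "A 1 = d *\<^sub>C 1"
    using assms(2) by (simp add: regular_def)
  note contraction = regular_contraction[OF state lin idem _ assms(2)]
  have norm: "complex_of_real (l2_op_norm \<psi> A) = d" if real: "real_map A"
  proof -
    obtain r where d: "d = complex_of_real r" and r: "0 \<le> r"
      using regular_degree_nonneg[OF state lin idem real A1] by metis
    have "l2_op_norm \<psi> A = r"
      using contraction[OF real] A1 r unfolding d by (intro l2_op_norm_eqI[OF state]) simp_all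
    with d show ?thesis by simp
  qed
  have "spec A \<subseteq> complex_of_real ` {- Re d .. Re d}" if "undirected \<psi> A"
    using that contraction
    by (intro selfadjoint_spec_bounded[OF state lin]) (auto simp: undirected_def)
  with norm show ?thesis
    by (auto simp: undirected_def)
qed

end
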